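(* Let $n\ge1$ be an integer and let $f:[-1,1]\to\mathbb{C}$ be $n$ times continuously differentiable. Let $F(y)=\frac12[f(\sqrt y)+f(-\sqrt y)]$ for $y\in[0,1]$, and let $I(\alpha)$ denote the meromorphic continuation in $\alpha$ (Hadamard regularisation) of $\int_{-1}^1 f(x)(1-x^2)^{-\alpha}\,dx$. Then, in this sense, $$I\left(n+\tfrac12\right)=\int_0^1 y^{-1/2}(1-y)^{-n-\frac12}\left[F(y)-F(1)-(y-1)F'(1)-\cdots-\frac{1}{(n-1)!}(y-1)^{n-1}F^{(n-1)}(1)\right]dy,$$ the integral on the right being a convergent ordinary integral.
   Context: The integral $\int_{-1}^1 f(x)(1-x^2)^{-\alpha}dx$ converges for $\operatorname{Re}\alpha<1$; the Hadamard regularised value (partie finie) at $\alpha=n+\frac12$ is the value there of its meromorphic continuation in $\alpha$. The derivatives $F^{(k)}(1)$ are one-sided derivatives at $y=1$. *)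

theory Defs
  imports "HOL-Complex_Analysis.Complex_Analysis"
begin

text \<open>Derivatives are taken within \<open>S\<close>, so on a closed interval they are one-sided at the
  endpoints and only the values of the function on \<open>S\<close> matter.\<close>

definition nderiv_within :: "nat \<Rightarrow> (real \<Rightarrow> complex) \<Rightarrow> real set \<Rightarrow> real \<Rightarrow> complex" where
  "nderiv_within k f S = ((\<lambda>g x. vector_derivative g (at x within S)) ^^ k) f"

definition n_times_continuously_differentiable_on ::
    "nat \<Rightarrow> (real \<Rightarrow> complex) \<Rightarrow> real set \<Rightarrow> bool" where
  "n_times_continuously_differentiable_on n f S \<longleftrightarrow>
     (\<forall>k<n. \<forall>x\<in>S. nderiv_within k f S differentiable (at x within S)) \<and>
     continuous_on S (nderiv_within n f S)"

text \<open>\<open>nicely_meromorphic_on\<close> rather than \<open>meromorphic_on\<close>: the latter leaves the values at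
  removable singularities arbitrary, so the value of \<open>I\<close> at a point would not be determined.
  The domain \<open>D\<close> matters: for \<open>f\<close> that is merely \<open>n\<close> times continuously differentiable, continuation
  around the point \<open>n + 1\<close> may be multivalued, so \<open>D\<close> is meant to be a half-plane \<open>{\<alpha>. Re \<alpha> < c}\<close>.\<close>

definition is_meromorphic_continuation ::
    "(real \<Rightarrow> complex) \<Rightarrow> complex set \<Rightarrow> (complex \<Rightarrow> complex) \<Rightarrow> bool" where
  "is_meromorphic_continuation f D I \<longleftrightarrow>
     {\<alpha>. Re \<alpha> < 1} \<subseteq> D \<and> I nicely_meromorphic_on D \<and>
     (\<forall>\<alpha>. Re \<alpha> < 1 \<longrightarrow>
        ((\<lambda>x. f x * complex_of_real (1 - x\<^sup>2) powr (- \<alpha>)) has_integral I \<alpha>) {-1..1})"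

end

theory Submission
  imports Defs
begin

text \<open>Write \<open>F = T + R\<close> with \<open>T\<close> the Taylor polynomial of degree \<open>n - 1\<close> at \<open>1\<close>, so \<open>R y = O ((1 - y) ^ n)\<close>.
  With \<open>y = x\<^sup>2\<close>, the integral for \<open>Re \<alpha> < 1\<close> becomes the integral of the remainder, which is
  holomorphic for \<open>Re \<alpha> < n + 1\<close>, plus a combination of the Beta values \<open>B(1/2, 1 + k - \<alpha>)\<close>, \<open>k < n\<close>.
  At \<open>\<alpha> = n + 1/2\<close> each of these has the factor \<open>1/\<Gamma>(k + 1 - n) = 0\<close>, so only the remainder survives.\<close>

text \<open>Two obstacles shape the proof. The square root is not differentiable at 0, so F is in
  general only n times continuously differentiable on (0,1]. Taylor's formula is therefore used only
  away from 0; near 0 mere boundedness suffices, because (1 - y)^n stays away from zero there.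
  Secondly, the original integral need not converge at n + 1/2, so its regularised value is reached
  only through an explicit candidate, matched for Re \<alpha> < 1 and carried over by the identity
  theorem. The half-integer matters twice: the remainder leaves the integrable exponent n - (n +
  1/2) = -1/2 at the endpoint, and the Gamma factor beside the vanishing 1/\<Gamma> is taken at a
  half-integer, so no pole compensates that zero.\<close>

section \<open>Continuously differentiable functions\<close>

text \<open>The derivative is an existential witness instead of a value of
  \<open>vector_derivative\<close>. Sums, products and composites can then be handled by induction
  on the order: the witness is written down, and no iterated derivative has to be computed.\<close>

primrec cont_diff :: "nat \<Rightarrow> (real \<Rightarrow> complex) \<Rightarrow> real set \<Rightarrow> bool" where
  "cont_diff 0 f S \<longleftrightarrow> continuous_on S f"
| "cont_diff (Suc k) f S \<longleftrightarrow>
     (\<exists>f'. (\<forall>x\<in>S. (f has_vector_derivative f' x) (at x within S)) \<and> cont_diff k f' S)"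

lemma cont_diff_Suc_D: "cont_diff (Suc k) f S \<Longrightarrow> cont_diff k f S"
proof (induction k arbitrary: f)
  case 0
  then show ?case
    by (auto simp: continuous_on_eq_continuous_within dest: has_vector_derivative_continuous)
next
  case (Suc k)
  from Suc.prems obtain f' where
    "\<forall>x\<in>S. (f has_vector_derivative f' x) (at x within S)" "cont_diff (Suc k) f' S"
    unfolding cont_diff.simps(2)[of "Suc k"] by blast
  with Suc.IH[of f'] show ?case unfolding cont_diff.simps(2)[of k f] by blast
qed

lemma cont_diff_imp_continuous_on: "cont_diff k f S \<Longrightarrow> continuous_on S f"
proof (induction k)
  case (Suc k)
  then show ?case using cont_diff_Suc_D by blast
qed simp

lemma cont_diff_add:
  "cont_diff k f S \<Longrightarrow> cont_diff k g S \<Longrightarrow> cont_diff k (\<lambda>x. f x + g x) S"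
proof (induction k arbitrary: f g)
  case 0
  then show ?case by (simp add: continuous_on_add)
next
  case (Suc k)
  from Suc.prems obtain f' g' where "\<forall>x\<in>S. (f has_vector_derivative f' x) (at x within S)" "cont_diff k f' S"
    "\<forall>x\<in>S. (g has_vector_derivative g' x) (at x within S)" "cont_diff k g' S"
    unfolding cont_diff.simps by blast
  with Suc.IH[of f' g'] show ?case
    unfolding cont_diff.simps
    by (intro exI[of _ "\<lambda>x. f' x + g' x"] conjI ballI has_vector_derivative_add) auto
qed

lemma cont_diff_mult:
  "cont_diff k f S \<Longrightarrow> cont_diff k g S \<Longrightarrow> cont_diff k (\<lambda>x. f x * g x) S"
proof (induction k arbitrary: f g)
  case 0
  then show ?case by (simp add: continuous_on_mult)
next
  case (Suc k)
  from Suc.prems obtain f' g' where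
    d: "\<forall>x\<in>S. (f has_vector_derivative f' x) (at x within S)" "cont_diff k f' S"
       "\<forall>x\<in>S. (g has_vector_derivative g' x) (at x within S)" "cont_diff k g' S"
    unfolding cont_diff.simps by blast
  \<comment> \<open>The product rule keeps \<open>f\<close> and \<open>g\<close> themselves beside
    their derivatives, so both are also needed at the lower order \<open>k\<close>.\<close>
  note fg = cont_diff_Suc_D[OF Suc.prems(1)] cont_diff_Suc_D[OF Suc.prems(2)]
  have "cont_diff k (\<lambda>x. f x * g' x + f' x * g x) S"
    by (rule cont_diff_add[OF Suc.IH[OF fg(1) d(4)] Suc.IH[OF d(2) fg(2)]])
  moreover have "((\<lambda>x. f x * g x) has_vector_derivative f x * g' x + f' x * g x) (at x within S)"
    if "x \<in> S" for x
    using d that by (intro has_vector_derivative_mult) blast+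
  ultimately show ?case
    unfolding cont_diff.simps by (intro exI[of _ "\<lambda>x. f x * g' x + f' x * g x"] conjI ballI)
qed

text \<open>Differentiation only changes the coefficient and the exponent, so the induction runs
  over all \<open>c\<close> and \<open>a\<close> at once. The family contains the square root, its
  derivative and, with exponent 0, the constants.\<close>

lemma cont_diff_powr:
  assumes "S \<subseteq> {0<..}"
  shows "cont_diff k (\<lambda>y. of_real (c * y powr a)) S"
proof (induction k arbitrary: c a)
  case 0
  show ?case
    unfolding cont_diff.simps by (intro continuous_intros) (use assms in auto)
next
  case (Suc k)
  have "((\<lambda>y. complex_of_real (c * y powr a)) has_vector_derivative
          of_real ((c * a) * y powr (a - 1))) (at y within S)" if "y \<in> S" for y
  proof (rule has_vector_derivative_of_real)
    have "((\<lambda>y. y powr a) has_real_derivative a * y powr (a - 1)) (at y within S)"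
      using that assms by (intro has_field_derivative_at_within[OF has_real_derivative_powr]) auto
    from DERIV_cmult[OF this, of c]
    show "((\<lambda>y. c * y powr a) has_real_derivative (c * a) * y powr (a - 1)) (at y within S)"
      by (simp only: mult.assoc)
  qed
  with Suc[of "c * a" "a - 1"] show ?case
    unfolding cont_diff.simps
    by (intro exI[of _ "\<lambda>y. of_real ((c * a) * y powr (a - 1))"] conjI ballI)
qed

text \<open>By the chain rule one derivative of the composite is \<open>s'\<close> times a composite
  whose outer function has one order less. The product rule then closes the induction, and no
  formula for higher derivatives of composites is needed.\<close>

lemma cont_diff_compose:
  assumes "\<And>x. x \<in> S \<Longrightarrow> s x \<in> T"
    and "\<And>x. x \<in> S \<Longrightarrow> (s has_vector_derivative s' x) (at x within S)"
    and "\<And>k. cont_diff k (\<lambda>x. of_real (s' x)) S"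
  shows "cont_diff k f T \<Longrightarrow> cont_diff k (\<lambda>x. f (s x)) S"
proof (induction k arbitrary: f)
  case 0
  have "continuous_on S s"
    using assms(2) by (auto simp: continuous_on_eq_continuous_within dest: has_vector_derivative_continuous)
  with 0 show ?case
    by (auto intro!: continuous_on_compose2[of T f S s] assms(1))
next
  case (Suc k)
  from Suc.prems obtain f' where f': "\<forall>x\<in>T. (f has_vector_derivative f' x) (at x within T)" "cont_diff k f' T"
    unfolding cont_diff.simps by blast
  have "((\<lambda>x. f (s x)) has_vector_derivative of_real (s' x) * f' (s x)) (at x within S)"
    if "x \<in> S" for x
  proof -
    have "(f has_vector_derivative f' (s x)) (at (s x) within s ` S)"
      by (rule has_vector_derivative_within_subset[of f _ _ T]) (use f' assms(1) that in auto)
    from vector_diff_chain_within[OF assms(2)[OF that] this] show ?thesis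
      by (simp add: o_def scaleR_conv_of_real)
  qed
  moreover have "cont_diff k (\<lambda>x. of_real (s' x) * f' (s x)) S"
    by (intro cont_diff_mult assms(3) Suc.IH f')
  ultimately show ?case
    unfolding cont_diff.simps by (intro exI[of _ "\<lambda>x. of_real (s' x) * f' (s x)"] conjI ballI)
qed

section \<open>Comparison with iterated one-sided derivatives\<close>

lemma nderiv_within_0: "nderiv_within 0 f S = f"
  by (simp add: nderiv_within_def)

lemma nderiv_within_Suc:
  "nderiv_within (Suc k) f S = nderiv_within k (\<lambda>x. vector_derivative f (at x within S)) S"
  by (simp add: nderiv_within_def funpow_Suc_right del: funpow.simps)

lemma nderiv_within_Suc':
  "nderiv_within (Suc k) f S x = vector_derivative (nderiv_within k f S) (at x within S)"
  by (simp add: nderiv_within_def)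

text \<open>A derivative within a set depends only on the filter at the point and on the values
  along it, so the order can be raised inductively. This replaces \<open>{0..1}\<close> by
  \<open>{0<..1}\<close> without changing the derivatives at 1.\<close>

lemma nderiv_within_cong:
  assumes "T \<subseteq> S" "\<And>x. x \<in> T \<Longrightarrow> at x within S = at x within T"
    and "\<And>x. x \<in> T \<Longrightarrow> f x = g x"
    and "x \<in> T"
  shows "nderiv_within k f S x = nderiv_within k g T x"
  using assms(3,4)
proof (induction k arbitrary: x)
  case 0
  then show ?case by (simp add: nderiv_within_def)
next
  case (Suc k)
  have "(nderiv_within k f S has_vector_derivative D) (at x within T) \<longleftrightarrow>
        (nderiv_within k g T has_vector_derivative D) (at x within T)" for D
    using Suc by (intro has_vector_derivative_cong_ev) (auto simp: eventually_at_filter)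
  then show ?case
    using assms(2) Suc.prems by (simp add: nderiv_within_Suc' vector_derivative_def)
qed

text \<open>Where the filter is not \<open>bot\<close>, derivatives are unique, so any witness in
  \<open>cont_diff\<close> agrees on \<open>S\<close> with \<open>vector_derivative\<close>.\<close>

lemma cont_diff_iff_n_times_continuously_differentiable_on:
  assumes "\<And>x. x \<in> S \<Longrightarrow> at x within S \<noteq> bot"
  shows "cont_diff k f S \<longleftrightarrow> n_times_continuously_differentiable_on k f S"
proof (induction k arbitrary: f)
  case 0
  then show ?case by (simp add: n_times_continuously_differentiable_on_def nderiv_within_def)
next
  case (Suc k)
  let ?f' = "\<lambda>x. vector_derivative f (at x within S)"
  \<comment> \<open>The witness and \<open>vector_derivative\<close> are known to agree only on
    \<open>S\<close>, so \<open>cont_diff\<close> must be shown to ignore all other points.\<close>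
  have cong: "cont_diff k g S \<longleftrightarrow> cont_diff k h S" if "\<And>x. x \<in> S \<Longrightarrow> g x = h x" for g h k
  proof (cases k)
    case 0
    with that show ?thesis using continuous_on_cong[OF refl that, of S] by simp
  next
    case (Suc j)
    have "(g has_vector_derivative D) (at x within S) \<longleftrightarrow> (h has_vector_derivative D) (at x within S)"
      if "x \<in> S" for D x
      using \<open>\<And>x. x \<in> S \<Longrightarrow> g x = h x\<close> that
      by (intro has_vector_derivative_cong_ev) (auto simp: eventually_at_filter)
    then show ?thesis unfolding Suc cont_diff.simps by meson
  qed
  have "cont_diff (Suc k) f S \<longleftrightarrow> (\<forall>x\<in>S. f differentiable (at x within S)) \<and> cont_diff k ?f' S"
  proof safe
    fix x assume "cont_diff (Suc k) f S" "x \<in> S"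
    then show "f differentiable (at x within S)"
      unfolding cont_diff.simps by (blast intro: differentiableI_vector)
  next
    assume "cont_diff (Suc k) f S"
    then obtain f' where f': "\<forall>x\<in>S. (f has_vector_derivative f' x) (at x within S)" "cont_diff k f' S"
      unfolding cont_diff.simps by blast
    then have "?f' x = f' x" if "x \<in> S" for x
      using vector_derivative_within[OF assms[OF that]] that by blast
    from cong[of ?f' f' k, OF this] f'(2) show "cont_diff k ?f' S" by (rule iffD2)
  next
    assume "\<forall>x\<in>S. f differentiable (at x within S)" "cont_diff k ?f' S"
    then show "cont_diff (Suc k) f S"
      unfolding cont_diff.simps vector_derivative_works by (intro exI[of _ ?f'] conjI)
  qed
  also have "\<dots> \<longleftrightarrow> (\<forall>x\<in>S. f differentiable (at x within S)) \<and>
      n_times_continuously_differentiable_on k ?f' S"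
    by (simp only: Suc.IH)
  also have "\<dots> \<longleftrightarrow> n_times_continuously_differentiable_on (Suc k) f S"
    unfolding n_times_continuously_differentiable_on_def All_less_Suc2 nderiv_within_Suc
      nderiv_within_0 by (simp only: conj_assoc)
  finally show ?case .
qed

section \<open>The even part in the variable y = x^2: regularity on (0,1] and Taylor remainder at
  1\<close>

lemma at_within_Icc_eq_Ioc:
  assumes "x \<in> {a<..b::real}"
  shows "at x within {a..b} = at x within {a<..b}"
  by (rule at_within_nhd[of _ "{a<..}"]) (use assms in auto)

lemma at_within_Ioc_neq_bot:
  assumes "x \<in> {a<..b::real}"
  shows "at x within {a<..b} \<noteq> bot"
proof -
  have "x islimpt {a..b}" using assms by (subst islimpt_Icc) auto
  then show ?thesis
    using assms by (simp add: at_within_Icc_eq_Ioc[symmetric] trivial_limit_within)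
qed

text \<open>On (0,1] both summands are composites of \<open>f\<close> with a smooth function, namely
  \<open>c * y powr (1/2)\<close> with \<open>c\<close> = 1 or -1. At 0 this fails, hence the
  half-open interval.\<close>

lemma n_times_continuously_differentiable_on_even_part_sqrt:
  assumes f: "n_times_continuously_differentiable_on n f {-1..1}"
    and F: "\<And>y. y \<in> {0..1} \<Longrightarrow> F y = (f (sqrt y) + f (- sqrt y)) / 2"
  shows "n_times_continuously_differentiable_on n F {0<..1}"
proof -
  have S: "at x within {0<..1} \<noteq> bot" if "x \<in> {0<..1::real}" for x
    using at_within_Ioc_neq_bot[of x 0 1] that by simp
  have f': "cont_diff n f {-1..1}"
    using f by (subst cont_diff_iff_n_times_continuously_differentiable_on)
               (auto simp: trivial_limit_within islimpt_Icc)
  have comp: "cont_diff n (\<lambda>y. f (c * y powr (1/2))) {0<..1}" if "c \<in> {-1,1}" for c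
  proof (rule cont_diff_compose[of _ _ "{-1..1}" "\<lambda>y. (c/2) * y powr (-1/2)"])
    fix x :: real assume x: "x \<in> {0<..1}"
    then have "x powr (1/2) \<le> 1" "0 \<le> x powr (1/2)" by (auto simp: powr_le1)
    then have "-1 \<le> x powr (1/2)" by linarith
    with \<open>x powr (1/2) \<le> 1\<close> show "c * x powr (1/2) \<in> {-1..1}"
      using that by auto
    show "((\<lambda>y. c * y powr (1/2)) has_vector_derivative (c/2) * x powr (-1/2)) (at x within {0<..1})"
      unfolding has_real_derivative_iff_has_vector_derivative[symmetric]
      using x by (auto intro!: derivative_eq_intros)
  next
    show "cont_diff k (\<lambda>y. complex_of_real ((c/2) * y powr (-1/2))) {0<..1}" for k
      by (rule cont_diff_powr) auto
  qed (use f' in auto)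
  \<comment> \<open>The factor \<open>1/2\<close> is written with \<open>y powr 0\<close> so that \<open>cont_diff_powr\<close> applies to it.\<close>
  have "cont_diff n (\<lambda>y. of_real ((1/2) * y powr 0) *
          (f (1 * y powr (1/2)) + f (-1 * y powr (1/2)))) {0<..1}"
    by (intro cont_diff_mult cont_diff_add comp cont_diff_powr) auto
  then have *: "n_times_continuously_differentiable_on n (\<lambda>y. of_real ((1/2) * y powr 0) *
          (f (1 * y powr (1/2)) + f (-1 * y powr (1/2)))) {0<..1}"
    by (subst (asm) cont_diff_iff_n_times_continuously_differentiable_on) (use S in auto)
  let ?H = "\<lambda>y. of_real ((1/2) * y powr 0) * (f (1 * y powr (1/2)) + f (-1 * y powr (1/2)))"
  have eq: "nderiv_within k F {0<..1} x = nderiv_within k ?H {0<..1} x" if "x \<in> {0<..1}" for k x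
    by (rule nderiv_within_cong) (use that in \<open>auto simp: F powr_half_sqrt\<close>)
  have "nderiv_within k F {0<..1} differentiable (at x within {0<..1})"
    if "k < n" "x \<in> {0<..1}" for k x
  proof (rule differentiable_transform_within)
    show "nderiv_within k ?H {0<..1} differentiable (at x within {0<..1})"
      using * that unfolding n_times_continuously_differentiable_on_def by blast
  qed (rule zero_less_one that eq[symmetric] | assumption)+
  moreover have "continuous_on {0<..1} (nderiv_within n F {0<..1})"
  proof (rule continuous_on_eq)
    show "continuous_on {0<..1} (nderiv_within n ?H {0<..1})"
      using * unfolding n_times_continuously_differentiable_on_def by blast
  qed (rule eq[symmetric])
  ultimately show ?thesis unfolding n_times_continuously_differentiable_on_def by blast
qed

text \<open>Taylor's formula with integral remainder expands at a left endpoint, so the reflection t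
  = 1 - y moves the base point 1 to 0. The cut-off \<open>a\<close> provides a compact interval on
  which the derivative of order \<open>n\<close> is bounded; it may be unbounded near 0.\<close>

lemma norm_Taylor_remainder_right_le:
  fixes F :: "real \<Rightarrow> complex"
  assumes n: "n \<ge> 1" and F: "n_times_continuously_differentiable_on n F {0<..1}"
    and a: "0 < a" "a \<le> 1"
  obtains C where "\<And>y. y \<in> {a..1} \<Longrightarrow>
    norm (F y - (\<Sum>k<n. of_real ((y - 1) ^ k / fact k) * nderiv_within k F {0<..1} 1)) \<le> C * (1 - y) ^ n"
proof -
  let ?S = "{0<..1::real}"
  define D where "D k = nderiv_within k F ?S" for k
  have D: "(D k has_vector_derivative D (Suc k) x) (at x within ?S)" if "k < n" "x \<in> ?S" for k x
    using F that unfolding D_def nderiv_within_Suc'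
    by (auto simp: n_times_continuously_differentiable_on_def vector_derivative_works)
  have "continuous_on {a..1} (D n)"
    using F a unfolding D_def n_times_continuously_differentiable_on_def
    by (auto intro: continuous_on_subset)
  then have "bounded (D n ` {a..1})"
    by (intro compact_imp_bounded compact_continuous_image) auto
  then obtain M where M: "\<And>x. x \<in> {a..1} \<Longrightarrow> norm (D n x) \<le> M" "M > 0"
    unfolding bounded_pos by blast
  have "norm (F y - (\<Sum>k<n. of_real ((y - 1) ^ k / fact k) * D k 1)) \<le> M * (1 - y) ^ n"
    if y: "y \<in> {a..1}" for y
  proof -
    define b where "b = 1 - y"
    \<comment> \<open>\<open>E m\<close> is the derivative of order \<open>m\<close> of t -> F (1 -
      t). Its signs later turn the powers of 1 - y into powers of y - 1.\<close>
    define E where "E m t = (-1) ^ m * D m (1 - t)" for m t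
    have b: "0 \<le> b" "b \<le> 1 - a" using y by (auto simp: b_def)
    have E: "(E m has_vector_derivative E (Suc m) t) (at t within {0..b})"
      if "m < n" "0 \<le> t" "t \<le> b" for m t
    proof -
      have "((\<lambda>t. 1 - t) has_vector_derivative -1) (at t within {0..b})"
        by (auto intro!: derivative_eq_intros)
      moreover have "(D m has_vector_derivative D (Suc m) (1 - t)) (at (1 - t) within (\<lambda>t. 1 - t) ` {0..b})"
        using that a b by (intro has_vector_derivative_within_subset[OF D]) auto
      ultimately have "((D m \<circ> (\<lambda>t. 1 - t)) has_vector_derivative (-1) *\<^sub>R D (Suc m) (1 - t)) (at t within {0..b})"
        by (rule vector_diff_chain_within)
      then have "((\<lambda>t. (-1) ^ m * D m (1 - t)) has_vector_derivative (-1) ^ m * (- D (Suc m) (1 - t))) (at t within {0..b})"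
        by (intro has_vector_derivative_mult_right) (simp add: o_def)
      then show ?thesis
        unfolding E_def by simp
    qed
    have "((\<lambda>x. ((b - x) ^ (n - 1) / fact (n - 1)) *\<^sub>R E n x) has_integral
        E 0 b - (\<Sum>i<n. ((b - 0) ^ i / fact i) *\<^sub>R E i 0)) {0..b}"
      by (rule Taylor_has_integral) (use n b E in auto)
    moreover have "norm (((b - x) ^ (n - 1) / fact (n - 1)) *\<^sub>R E n x) \<le> b ^ (n - 1) * M"
      if "x \<in> {0..b}" for x
    proof -
      have "(b - x) ^ (n - 1) / fact (n - 1) \<le> b ^ (n - 1) / 1"
        using that by (intro frac_le power_mono) auto
      moreover have "norm (E n x) \<le> M"
        using that b M(1)[of "1 - x"] by (simp add: E_def norm_mult norm_power)
      ultimately show ?thesis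
        unfolding norm_scaleR using that b M(2)
        by (intro mult_mono) auto
    qed
    \<comment> \<open>The integrand contributes n - 1 factors \<open>b\<close>; the length of the
      interval contributes the last one.\<close>
    ultimately have "norm (E 0 b - (\<Sum>i<n. ((b - 0) ^ i / fact i) *\<^sub>R E i 0)) \<le> b ^ (n - 1) * M * measure lborel (cbox 0 b)"
      using b M(2) by (intro has_integral_bound[where f = "\<lambda>x. ((b - x) ^ (n - 1) / fact (n - 1)) *\<^sub>R E n x"]) auto
    also have "b ^ (n - 1) * M * measure lborel (cbox 0 b) = M * (1 - y) ^ n"
      using b n by (cases n) (auto simp: b_def)
    also have "E 0 b - (\<Sum>i<n. ((b - 0) ^ i / fact i) *\<^sub>R E i 0) =
               F y - (\<Sum>k<n. of_real ((y - 1) ^ k / fact k) * D k 1)"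
    proof -
      have "(y - 1) ^ k = (-1) ^ k * (1 - y) ^ k" for k
        by (metis minus_diff_eq power_minus)
      then show ?thesis
        by (simp add: E_def b_def D_def nderiv_within_0 scaleR_conv_of_real mult_ac)
    qed
    finally show ?thesis .
  qed
  then show ?thesis using that unfolding D_def by blast
qed

section \<open>Integrals of powers of \<open>1 - x\<^sup>2\<close>\<close>

lemma has_integral_one_minus_powr:
  fixes s e :: real
  assumes "s > -1" "0 \<le> e"
  shows "((\<lambda>x. (1 - x) powr s) has_integral e powr (s + 1) / (s + 1)) {1-e..1}"
proof -
  have "((\<lambda>x. x powr s) has_integral e powr (s + 1) / (s + 1)) {0..e}"
    by (rule has_integral_powr_from_0) (use assms in auto)
  then have "((\<lambda>x. (- x) powr s) has_integral e powr (s + 1) / (s + 1)) {-e..-0}"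
    by (subst has_integral_reflect_real[of "\<lambda>x. x powr s"])
  then have "((\<lambda>x. (- x) powr s) has_integral e powr (s + 1) / (s + 1)) (cbox (-e) 0)"
    by simp
  from has_integral_affinity[OF this, of 1 "-1"] show ?thesis
    by (simp add: image_affinity_atLeastAtMost add.commute)
qed

text \<open>In 1 - x^2 = (1 - x)(1 + x) the second factor lies between 1 and 2, so its power is at
  most \<open>2 powr M\<close>. The bound sees \<alpha> only through \<open>r\<close> and
  \<open>M\<close>, which makes it uniform on discs. At x = 1 both sides are 0, since
  \<open>0 powr _ = 0\<close>.\<close>

lemma norm_one_minus_square_powr_le:
  assumes g: "\<And>x. x \<in> {0..<1} \<Longrightarrow> norm (g x) \<le> C * (1 - x) ^ m"
    and \<alpha>: "Re \<alpha> \<le> r" "\<bar>Re \<alpha>\<bar> \<le> M" and x: "x \<in> {0..1}"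
  shows "norm (g x * complex_of_real (1 - x\<^sup>2) powr (-\<alpha>)) \<le> C * 2 powr M * (1 - x) powr (real m - r)"
proof (cases "x = 1")
  case False
  with x have x: "x \<in> {0..<1}" by simp
  have C: "0 \<le> C * (1 - x) ^ m"
    using g[OF x] norm_ge_zero order_trans by blast
  have "x\<^sup>2 < 1" using x by (simp add: power_less_one_iff abs_square_less_1)
  then have "norm (complex_of_real (1 - x\<^sup>2) powr (-\<alpha>)) = (1 - x\<^sup>2) powr (- Re \<alpha>)"
    by (subst norm_powr_real_powr) auto
  also have "\<dots> = ((1 - x) * (1 + x)) powr (- Re \<alpha>)"
    by (simp add: algebra_simps power2_eq_square)
  also have "\<dots> = (1 - x) powr (- Re \<alpha>) * (1 + x) powr (- Re \<alpha>)"
    using x by (simp add: powr_mult)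
  also have "\<dots> \<le> (1 - x) powr (- r) * 2 powr M"
  proof (rule mult_mono)
    show "(1 - x) powr (- Re \<alpha>) \<le> (1 - x) powr (- r)"
      using x \<alpha> by (intro powr_mono') auto
    have "(1 + x) powr (- Re \<alpha>) \<le> (1 + x) powr M"
      using x \<alpha> by (intro powr_mono) auto
    also have "\<dots> \<le> 2 powr M"
      using x \<alpha> by (intro powr_mono2) auto
    finally show "(1 + x) powr (- Re \<alpha>) \<le> 2 powr M" .
  qed auto
  finally have w: "norm (complex_of_real (1 - x\<^sup>2) powr (-\<alpha>)) \<le> (1 - x) powr (- r) * 2 powr M" .
  have "norm (g x * complex_of_real (1 - x\<^sup>2) powr (-\<alpha>)) \<le>
      (C * (1 - x) ^ m) * ((1 - x) powr (- r) * 2 powr M)"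
    unfolding norm_mult by (intro mult_mono g x C w) auto
  also have "\<dots> = C * 2 powr M * ((1 - x) powr real m * (1 - x) powr (- r))"
    using x by (simp add: powr_realpow mult_ac)
  also have "\<dots> = C * 2 powr M * (1 - x) powr (real m - r)"
    by (simp add: powr_add[symmetric])
  finally show ?thesis .
qed auto

lemma continuous_on_one_minus_square_powr:
  assumes "continuous_on S g" "S \<subseteq> {0..<1}"
  shows "continuous_on S (\<lambda>x. g x * complex_of_real (1 - x\<^sup>2) powr (-\<alpha>))"
proof (intro continuous_on_mult assms continuous_on_powr_complex continuous_on_of_real
    continuous_on_diff continuous_on_power continuous_on_const continuous_on_id)
  have "x\<^sup>2 < 1" if "x \<in> S" for x :: real
    using that assms(2) by (auto simp: abs_square_less_1)
  then show "S \<subseteq> {z. 0 \<le> Re (complex_of_real (1 - z\<^sup>2)) \<or> Im (complex_of_real (1 - z\<^sup>2)) \<noteq> 0}"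
    by (auto intro: less_imp_le)
  show "\<And>z. z \<in> S \<Longrightarrow> complex_of_real (1 - z\<^sup>2) = 0 \<Longrightarrow> 0 < Re (-\<alpha>)"
    using \<open>\<And>x. x \<in> S \<Longrightarrow> x\<^sup>2 < 1\<close> by (metis of_real_eq_0_iff diff_gt_0_iff_gt less_irrefl)
qed

lemma absolutely_integrable_one_minus_square_powr:
  assumes g: "continuous_on {0..<1} g" "\<And>x. x \<in> {0..<1} \<Longrightarrow> norm (g x) \<le> C * (1 - x) ^ m"
    and \<alpha>: "Re \<alpha> < real m + 1"
  shows "(\<lambda>x. g x * complex_of_real (1 - x\<^sup>2) powr (-\<alpha>)) absolutely_integrable_on {0..1}"
proof -
  let ?w = "\<lambda>x. C * 2 powr \<bar>Re \<alpha>\<bar> * (1 - x) powr (real m - Re \<alpha>)"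
  have "?w integrable_on {0..1}"
    using has_integral_one_minus_powr[of "real m - Re \<alpha>" 1] \<alpha>
    by (intro integrable_on_mult_right) (auto simp: integrable_on_def)
  then have w: "?w integrable_on {0..<1}"
    by (rule integrable_spike_set) (auto intro: negligible_subset[of "{1}"])
  have "(\<lambda>x. g x * complex_of_real (1 - x\<^sup>2) powr (-\<alpha>)) absolutely_integrable_on {0..<1}"
  proof (rule measurable_bounded_by_integrable_imp_absolutely_integrable[OF _ _ w])
    show "(\<lambda>x. g x * complex_of_real (1 - x\<^sup>2) powr (-\<alpha>)) \<in> borel_measurable (lebesgue_on {0..<1})"
      by (intro continuous_imp_measurable_on_sets_lebesgue continuous_on_one_minus_square_powr g) auto
    show "norm (g x * complex_of_real (1 - x\<^sup>2) powr (-\<alpha>)) \<le> ?w x" if "x \<in> {0..<1}" for x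
      using that by (intro norm_one_minus_square_powr_le g) auto
  qed auto
  then show ?thesis
    by (rule absolutely_integrable_spike_set) (auto intro: negligible_subset[of "{1}"])
qed

text \<open>The kernel may be singular at x = 1, so differentiation under the integral is applied
  only on [0, 1 - e]. These truncations are entire in \<alpha> and converge uniformly on small
  closed discs.\<close>

lemma holomorphic_on_integral_one_minus_square_powr:
  assumes g: "continuous_on {0..<1} g" "\<And>x. x \<in> {0..<1} \<Longrightarrow> norm (g x) \<le> C * (1 - x) ^ m"
  shows "(\<lambda>\<alpha>. integral {0..1} (\<lambda>x. g x * complex_of_real (1 - x\<^sup>2) powr (-\<alpha>)))
           holomorphic_on {\<alpha>. Re \<alpha> < real m + 1}"
proof (rule holomorphic_uniform_sequence)
  define K where "K \<alpha> x = g x * complex_of_real (1 - x\<^sup>2) powr (-\<alpha>)" for \<alpha> x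
  define e where "e k = 1 / real (Suc k)" for k
  define P where "P k \<alpha> = integral (cbox 0 (1 - e k)) (K \<alpha>)" for k \<alpha>
  have e: "0 < e k" "e k \<le> 1" for k
    by (auto simp: e_def)
  have C: "0 \<le> C"
    using order_trans[OF norm_ge_zero g(2)[of 0]] by simp
  have K_int: "K \<alpha> integrable_on {0..1}" if "Re \<alpha> < real m + 1" for \<alpha>
    unfolding K_def
    using absolutely_integrable_one_minus_square_powr[OF g that] set_lebesgue_integral_eq_integral(1)
    by blast
  show "open {\<alpha>. Re \<alpha> < real m + 1}"
    by (rule open_halfspace_Re_lt)
  show "P k holomorphic_on {\<alpha>. Re \<alpha> < real m + 1}" for k
  proof (rule holomorphic_on_subset)
    show "P k holomorphic_on UNIV"
      unfolding P_def
    proof (rule leibniz_rule_holomorphic)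
      have pos: "x\<^sup>2 < 1" if "x \<in> cbox 0 (1 - e k)" for x
        using that e[of k] by (auto simp: abs_square_less_1)
      \<comment> \<open>On the truncated interval 1 - x^2 is positive, and the exponential form
        shows the derivative in \<alpha> and its joint continuity.\<close>
      have K_eq: "K \<alpha> x = g x * exp (- \<alpha> * complex_of_real (ln (1 - x\<^sup>2)))"
        if "x \<in> cbox 0 (1 - e k)" for \<alpha> x
        using pos[OF that] by (simp add: K_def powr_def Ln_of_real del: of_real_diff)
      let ?dK = "\<lambda>\<alpha> x. g x * (- complex_of_real (ln (1 - x\<^sup>2))) * exp (- \<alpha> * complex_of_real (ln (1 - x\<^sup>2)))"
      show "((\<lambda>\<alpha>. K \<alpha> x) has_field_derivative ?dK \<alpha> x) (at \<alpha> within UNIV)"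
        if "x \<in> cbox 0 (1 - e k)" for \<alpha> x
        unfolding K_eq[OF that] by (auto intro!: derivative_eq_intros)
      have gc: "continuous_on (cbox 0 (1 - e k)) g"
        by (rule continuous_on_subset[OF g(1)]) (use e[of k] in auto)
      show "K \<alpha> integrable_on cbox 0 (1 - e k)" for \<alpha>
        unfolding K_def
        by (intro integrable_continuous continuous_on_one_minus_square_powr gc) (use e[of k] in auto)
      have lnc: "continuous_on (UNIV \<times> cbox 0 (1 - e k)) (\<lambda>p::complex \<times> real. ln (1 - (snd p)\<^sup>2))"
        by (intro continuous_on_ln continuous_intros) (use pos in fastforce)
      show "continuous_on (UNIV \<times> cbox 0 (1 - e k)) (\<lambda>(\<alpha>, x). ?dK \<alpha> x)"
        unfolding case_prod_beta
        by (intro continuous_on_mult continuous_on_minus continuous_on_exp continuous_on_of_real lnc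
              continuous_on_fst continuous_on_id continuous_on_compose2[OF gc continuous_on_snd]) auto
    qed auto
  qed auto
  fix \<alpha>0 assume "\<alpha>0 \<in> {\<alpha>. Re \<alpha> < real m + 1}"
  then have \<alpha>0: "Re \<alpha>0 < real m + 1" by simp
  \<comment> \<open>Half the distance to the boundary line: on the closed disc Re \<alpha> is at
    most \<open>Re \<alpha>0 + d\<close>, and \<open>s\<close> equals \<open>d - 1\<close>, which
    exceeds -1.\<close>
  define d where "d = (real m + 1 - Re \<alpha>0) / 2"
  define s where "s = real m - (Re \<alpha>0 + d)"
  define A where "A = C * 2 powr (\<bar>Re \<alpha>0\<bar> + d)"
  have d: "d > 0" "s > -1" "A \<ge> 0"
    using \<alpha>0 C by (auto simp: d_def s_def A_def field_simps)
  have Re_le: "Re \<alpha> \<le> Re \<alpha>0 + d" "\<bar>Re \<alpha>\<bar> \<le> \<bar>Re \<alpha>0\<bar> + d" if "\<alpha> \<in> cball \<alpha>0 d" for \<alpha>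
    using that abs_Re_le_cmod[of "\<alpha> - \<alpha>0"] by (auto simp: dist_norm norm_minus_commute)
  have sub: "cball \<alpha>0 d \<subseteq> {\<alpha>. Re \<alpha> < real m + 1}"
    using Re_le(1) d(2) unfolding s_def by fastforce
  have bound: "dist (P k \<alpha>) (integral {0..1} (K \<alpha>)) \<le> A * (e k powr (s + 1) / (s + 1))"
    if \<alpha>: "\<alpha> \<in> cball \<alpha>0 d" for k \<alpha>
  proof -
    have int: "K \<alpha> integrable_on {0..1}"
      using K_int \<alpha> sub by auto
    have "integral {0..1} (K \<alpha>) = P k \<alpha> + integral {1 - e k..1} (K \<alpha>)"
      unfolding P_def using e[of k] int
      by (subst Henstock_Kurzweil_Integration.integral_combine[symmetric, of 0 "1 - e k" 1]) auto
    moreover have "norm (integral {1 - e k..1} (K \<alpha>)) \<le> integral {1 - e k..1} (\<lambda>x. A * (1 - x) powr s)"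
    proof (rule Henstock_Kurzweil_Integration.integral_norm_bound_integral)
      show "K \<alpha> integrable_on {1 - e k..1}"
        using int by (rule integrable_on_subinterval) (use e[of k] in auto)
      show "(\<lambda>x. A * (1 - x) powr s) integrable_on {1 - e k..1}"
        using has_integral_one_minus_powr[OF d(2), of "e k"] e[of k]
        by (intro integrable_on_mult_right) (auto simp: integrable_on_def)
      show "norm (K \<alpha> x) \<le> A * (1 - x) powr s" if "x \<in> {1 - e k..1}" for x
        unfolding K_def A_def s_def
        by (intro norm_one_minus_square_powr_le g Re_le \<alpha>) (use that e[of k] in auto)
    qed
    moreover have "integral {1 - e k..1} (\<lambda>x. A * (1 - x) powr s) = A * (e k powr (s + 1) / (s + 1))"
      using has_integral_one_minus_powr[OF d(2), of "e k"] e[of k]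
      by (intro integral_unique has_integral_mult_right) auto
    ultimately show ?thesis
      by (simp add: dist_norm)
  qed
  have "(\<lambda>k. A * (e k powr (s + 1) / (s + 1))) \<longlonglongrightarrow> A * (0 powr (s + 1) / (s + 1))"
  proof (intro tendsto_intros tendsto_powr')
    show "e \<longlonglongrightarrow> 0"
      unfolding e_def using LIMSEQ_inverse_real_of_nat by (simp add: inverse_eq_divide)
  qed (use d e(1)[THEN less_imp_le] in auto)
  then have lim: "(\<lambda>k. A * (e k powr (s + 1) / (s + 1))) \<longlonglongrightarrow> 0"
    by simp
  have "uniform_limit (cball \<alpha>0 d) P (\<lambda>\<alpha>. integral {0..1} (K \<alpha>)) sequentially"
  proof (rule uniform_limitI)
    fix r :: real assume "r > 0"
    with lim have "\<forall>\<^sub>F k in sequentially. A * (e k powr (s + 1) / (s + 1)) < r"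
      by (rule order_tendstoD)
    then show "\<forall>\<^sub>F k in sequentially. \<forall>\<alpha>\<in>cball \<alpha>0 d. dist (P k \<alpha>) (integral {0..1} (K \<alpha>)) < r"
      by eventually_elim (use bound in \<open>blast intro: le_less_trans\<close>)
  qed
  then show "\<exists>d>0. cball \<alpha>0 d \<subseteq> {\<alpha>. Re \<alpha> < real m + 1} \<and>
      uniform_limit (cball \<alpha>0 d) P
        (\<lambda>\<alpha>. integral {0..1} (\<lambda>x. g x * complex_of_real (1 - x\<^sup>2) powr (-\<alpha>))) sequentially"
    using d sub unfolding K_def by blast
qed

section \<open>The substitution y = x^2 and the Beta integral\<close>

lemma absolutely_integrable_square_substitution_iff:
  fixes h :: "real \<Rightarrow> 'a :: euclidean_space"
  shows "(\<lambda>x. (2 * x) *\<^sub>R h (x\<^sup>2)) absolutely_integrable_on {0..1} \<and>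
           integral {0..1} (\<lambda>x. (2 * x) *\<^sub>R h (x\<^sup>2)) = b \<longleftrightarrow>
         h absolutely_integrable_on {0..1} \<and> integral {0..1} h = b"
proof -
  have img: "(\<lambda>x. x\<^sup>2) ` {0..1} = {0..1::real}"
  proof (intro equalityI subsetI)
    fix y :: real assume "y \<in> {0..1}"
    then have "sqrt y \<in> {0..1}" "y = (sqrt y)\<^sup>2" by auto
    then show "y \<in> (\<lambda>x. x\<^sup>2) ` {0..1}" by blast
  qed (auto simp: power_le_one)
  \<comment> \<open>The equivalence is needed in both directions: from y to x for the Beta
    integrand, and from x to y to obtain integrability of \<open>G\<close>.\<close>
  have "(\<lambda>x. \<bar>2 * x\<bar> *\<^sub>R h (x\<^sup>2)) absolutely_integrable_on {0..1} \<and>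
          integral {0..1} (\<lambda>x. \<bar>2 * x\<bar> *\<^sub>R h (x\<^sup>2)) = b \<longleftrightarrow>
        h absolutely_integrable_on (\<lambda>x. x\<^sup>2) ` {0..1} \<and> integral ((\<lambda>x. x\<^sup>2) ` {0..1}) h = b"
  proof (rule has_absolute_integral_change_of_variables_real)
    show "inj_on (\<lambda>x::real. x\<^sup>2) {0..1}"
      by (auto simp: inj_on_def power2_eq_iff_nonneg)
  qed (auto intro!: derivative_eq_intros)
  moreover have "(\<lambda>x. \<bar>2 * x\<bar> *\<^sub>R h (x\<^sup>2)) absolutely_integrable_on {0..1} \<longleftrightarrow>
      (\<lambda>x. (2 * x) *\<^sub>R h (x\<^sup>2)) absolutely_integrable_on {0..1}"
    by (intro set_integrable_cong) auto
  moreover have "integral {0..1} (\<lambda>x. \<bar>2 * x\<bar> *\<^sub>R h (x\<^sup>2)) = integral {0..1} (\<lambda>x. (2 * x) *\<^sub>R h (x\<^sup>2))"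
    by (intro Henstock_Kurzweil_Integration.integral_cong) auto
  ultimately show ?thesis
    by (simp only: img)
qed

lemma has_integral_one_minus_square_powr_real:
  fixes b :: real
  assumes "b < 1"
  shows "((\<lambda>x. 2 * (1 - x\<^sup>2) powr (-b)) has_integral Beta (1/2) (1 - b)) {0..1}"
proof -
  let ?h = "\<lambda>t::real. t powr (1/2 - 1) * (1 - t) powr (1 - b - 1)"
  have I: "(?h has_integral Beta (1/2) (1 - b)) {0..1}"
    using assms by (intro has_integral_Beta_real) auto
  then have "?h absolutely_integrable_on {0..1}"
    by (intro nonnegative_absolutely_integrable_1) (auto simp: has_integral_integrable)
  with I have *: "(\<lambda>x. (2 * x) *\<^sub>R ?h (x\<^sup>2)) absolutely_integrable_on {0..1} \<and>
      integral {0..1} (\<lambda>x. (2 * x) *\<^sub>R ?h (x\<^sup>2)) = Beta (1/2) (1 - b)"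
    by (intro absolutely_integrable_square_substitution_iff[THEN iffD2] conjI integral_unique)
  have "((\<lambda>x. (2 * x) *\<^sub>R ?h (x\<^sup>2)) has_integral Beta (1/2) (1 - b)) {0..1}"
    using integrable_integral[OF set_lebesgue_integral_eq_integral(1)[OF conjunct1[OF *]]]
    by (simp only: conjunct2[OF *])
  then show ?thesis
  proof (rule has_integral_spike[rotated 2])
    \<comment> \<open>At x = 0 the Jacobian makes the substituted integrand 0 while the target is 2;
      this single point is negligible.\<close>
    fix x :: real assume "x \<in> {0..1} - {0}"
    then have "x > 0" by auto
    then have "(x\<^sup>2) powr (1/2 - 1) = inverse x"
      by (simp add: powr_powr powr_minus flip: powr_numeral)
    with \<open>x > 0\<close> show "2 * (1 - x\<^sup>2) powr (-b) = (2 * x) *\<^sub>R ?h (x\<^sup>2)"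
      by (simp add: field_simps)
  qed auto
qed

text \<open>Of the three Gamma factors of Beta, one is constant and the reciprocal one is entire, so
  poles come only from \<Gamma>(c - \<alpha>).\<close>

lemma analytic_on_Beta_half:
  assumes "\<And>\<alpha>. \<alpha> \<in> A \<Longrightarrow> c - \<alpha> \<notin> \<int>\<^sub>\<le>\<^sub>0"
  shows "(\<lambda>\<alpha>. Beta (1/2) (c - \<alpha>) :: complex) analytic_on A"
proof -
  have "(1/2 :: complex) \<notin> \<int>\<^sub>\<le>\<^sub>0"
    by (auto elim!: nonpos_Ints_cases dest!: arg_cong[of _ _ Re])
  then show ?thesis
    unfolding Beta_altdef using assms by (auto intro!: analytic_intros)
qed

lemma meromorphic_on_Beta_half: "(\<lambda>\<alpha>. Beta (1/2) (c - \<alpha>) :: complex) meromorphic_on A"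
proof -
  have rGamma: "(\<lambda>\<alpha>. rGamma (h \<alpha>)) meromorphic_on A" if "h analytic_on A" for h :: "complex \<Rightarrow> complex"
    using that by (intro analytic_on_imp_meromorphic_on
        analytic_on_compose[OF that analytic_rGamma, unfolded o_def])
  then show ?thesis
    unfolding Beta_altdef Gamma_def by (intro meromorphic_intros rGamma analytic_intros)
qed

text \<open>Both sides are holomorphic for Re \<beta> < 1 and agree on the real interval (0,1),
  which accumulates at 0 inside this half-plane. The identity theorem extends the real formula to
  complex exponents.\<close>

lemma has_integral_one_minus_square_powr:
  assumes "Re \<beta> < 1"
  shows "((\<lambda>x. 2 * complex_of_real (1 - x\<^sup>2) powr (-\<beta>)) has_integral Beta (1/2) (1 - \<beta>)) {0..1}"
proof -
  let ?S = "{\<beta>. Re \<beta> < 1}"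
  let ?U = "complex_of_real ` {0<..<1}"
  define P where "P \<beta> = integral {0..1} (\<lambda>x. 2 * complex_of_real (1 - x\<^sup>2) powr (-\<beta>))" for \<beta>
  have hol: "P holomorphic_on ?S"
    unfolding P_def using holomorphic_on_integral_one_minus_square_powr[of "\<lambda>_. 2" 2 0] by simp
  have "P \<beta> - Beta (1/2) (1 - \<beta>) = 0"
  proof (rule analytic_continuation[where f = "\<lambda>\<beta>. P \<beta> - Beta (1/2) (1 - \<beta>)"])
    have "1 - \<beta> \<notin> \<int>\<^sub>\<le>\<^sub>0" if "Re \<beta> < 1" for \<beta>
      using that by (auto elim!: nonpos_Ints_cases dest!: arg_cong[of _ _ Re])
    then show "(\<lambda>\<beta>. P \<beta> - Beta (1/2) (1 - \<beta>)) holomorphic_on ?S"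
      by (intro holomorphic_on_diff hol analytic_imp_holomorphic analytic_on_Beta_half) auto
    show "connected ?S"
      by (intro convex_connected convex_halfspace_Re_lt)
    show "0 islimpt ?U"
      unfolding islimpt_approachable
    proof (intro allI impI)
      fix e :: real assume "e > 0"
      then have "min e 1 / 2 \<in> {0<..<1}"
        by auto
      then have "complex_of_real (min e 1 / 2) \<in> ?U"
        by (rule imageI)
      moreover have "complex_of_real (min e 1 / 2) \<noteq> 0"
        "dist (complex_of_real (min e 1 / 2)) 0 < e"
        using \<open>e > 0\<close> by (auto simp: min_def norm_divide)
      ultimately show "\<exists>x'\<in>?U. x' \<noteq> 0 \<and> dist x' 0 < e"
        by blast
    qed
    show "P z - Beta (1/2) (1 - z) = 0" if "z \<in> ?U" for z
    proof -
      from that obtain b where b: "z = of_real b" "b < 1" by auto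
      have "((\<lambda>x. complex_of_real (2 * (1 - x\<^sup>2) powr (-b))) has_integral of_real (Beta (1/2) (1 - b))) {0..1}"
        by (intro has_integral_of_real has_integral_one_minus_square_powr_real b)
      also have "complex_of_real (Beta (1/2) (1 - b)) = Beta (1/2) (1 - z)"
        using Beta_complex_of_real[of "1/2" "1 - b"] by (simp add: b)
      finally have "integral {0..1} (\<lambda>x. complex_of_real (2 * (1 - x\<^sup>2) powr (-b))) = Beta (1/2) (1 - z)"
        by (rule integral_unique)
      moreover have "P z = integral {0..1} (\<lambda>x. complex_of_real (2 * (1 - x\<^sup>2) powr (-b)))"
        unfolding P_def
      proof (rule Henstock_Kurzweil_Integration.integral_cong)
        fix x :: real assume "x \<in> {0..1}"
        then have "x\<^sup>2 \<le> 1" by (simp add: power_le_one)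
        then show "2 * complex_of_real (1 - x\<^sup>2) powr (-z) = complex_of_real (2 * (1 - x\<^sup>2) powr (-b))"
          unfolding b of_real_minus[symmetric] by (subst powr_of_real) auto
      qed
      ultimately show ?thesis by simp
    qed
  qed (use assms in \<open>auto simp: open_halfspace_Re_lt\<close>)
  moreover have "(\<lambda>x. 2 * complex_of_real (1 - x\<^sup>2) powr (-\<beta>)) absolutely_integrable_on {0..1}"
    using assms by (intro absolutely_integrable_one_minus_square_powr[of "\<lambda>_. 2" 2 0]) auto
  then have "((\<lambda>x. 2 * complex_of_real (1 - x\<^sup>2) powr (-\<beta>)) has_integral P \<beta>) {0..1}"
    unfolding P_def using set_lebesgue_integral_eq_integral(1) by blast
  ultimately show ?thesis by simp
qed

section \<open>Meromorphic continuation\<close>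

text \<open>Here \<open>c k\<close> stands for \<open>F\<^sup>(\<^sup>k\<^sup>)(1) / k!\<close>; the factor \<open>2\<close> comes from \<open>f x + f (- x) = 2 * F (x\<^sup>2)\<close>.\<close>

definition even_remainder :: "(real \<Rightarrow> complex) \<Rightarrow> (nat \<Rightarrow> complex) \<Rightarrow> nat \<Rightarrow> real \<Rightarrow> complex" where
  "even_remainder f c n x = f x + f (- x) - 2 * (\<Sum>k<n. c k * of_real (x\<^sup>2 - 1) ^ k)"

text \<open>The sign comes from (x^2 - 1)^k = (-1)^k (1 - x^2)^k, and the factor 2 of the Taylor
  part is absorbed by the Beta integral of 2 (1 - x^2)^(k - \<alpha>).\<close>

definition even_continuation :: "(real \<Rightarrow> complex) \<Rightarrow> (nat \<Rightarrow> complex) \<Rightarrow> nat \<Rightarrow> complex \<Rightarrow> complex" where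
  "even_continuation f c n \<alpha> =
     integral {0..1} (\<lambda>x. even_remainder f c n x * complex_of_real (1 - x\<^sup>2) powr (-\<alpha>)) +
     (\<Sum>k<n. c k * (-1) ^ k * Beta (1/2) (1 + of_nat k - \<alpha>))"

lemma continuous_on_even_remainder:
  assumes "continuous_on {-1..1} f"
  shows "continuous_on {0..<1} (even_remainder f c n)"
  unfolding even_remainder_def
  by (intro continuous_intros continuous_on_compose2[OF assms]) auto

lemma even_continuation_at_half:
  "even_continuation f c n (of_nat n + 1/2) =
     integral {0..1} (\<lambda>x. even_remainder f c n x * complex_of_real (1 - x\<^sup>2) powr (- (of_nat n + 1/2)))"
proof -
  have "Beta (1/2) (1 + of_nat k - (of_nat n + 1/2) :: complex) = 0" if "k < n" for k
  proof -
    have eq: "(1/2 :: complex) + (1 + of_nat k - (of_nat n + 1/2)) = - of_nat (n - 1 - k)"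
      using that by (simp add: of_nat_diff Suc_le_eq algebra_simps)
    show ?thesis
      unfolding Beta_altdef eq by (simp add: rGamma_nonpos_Int)
  qed
  then show ?thesis by (simp add: even_continuation_def)
qed

text \<open>Taylor's formula enters here only through the bound \<open>remainder\<close>; the
  coefficients \<open>c\<close> are otherwise arbitrary.\<close>

context
  fixes f :: "real \<Rightarrow> complex" and c :: "nat \<Rightarrow> complex" and n :: nat and C :: real
  assumes f: "continuous_on {-1..1} f"
    and remainder: "\<And>x. x \<in> {0..<1} \<Longrightarrow> norm (even_remainder f c n x) \<le> C * (1 - x) ^ n"
begin

lemma analytic_on_even_continuation:
  assumes "Re \<alpha> < real n + 1" "\<And>k. k < n \<Longrightarrow> 1 + of_nat k - \<alpha> \<notin> \<int>\<^sub>\<le>\<^sub>0"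
  shows "even_continuation f c n analytic_on {\<alpha>}"
proof -
  have "(\<lambda>\<alpha>. integral {0..1} (\<lambda>x. even_remainder f c n x * complex_of_real (1 - x\<^sup>2) powr (-\<alpha>)))
      analytic_on {\<alpha>}"
    using holomorphic_on_integral_one_minus_square_powr[OF continuous_on_even_remainder[OF f] remainder] assms(1)
    by (auto simp: analytic_at intro!: exI[of _ "{\<alpha>. Re \<alpha> < real n + 1}"] open_halfspace_Re_lt)
  then show ?thesis
    unfolding even_continuation_def[abs_def]
    by (intro analytic_on_add analytic_on_sum analytic_on_mult analytic_on_const analytic_on_Beta_half)
       (use assms(2) in auto)
qed

lemma meromorphic_on_even_continuation:
  "even_continuation f c n meromorphic_on {\<alpha>. Re \<alpha> < real n + 1}"
proof -
  have "(\<lambda>\<alpha>. integral {0..1} (\<lambda>x. even_remainder f c n x * complex_of_real (1 - x\<^sup>2) powr (-\<alpha>)))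
      analytic_on {\<alpha>. Re \<alpha> < real n + 1}"
    using holomorphic_on_integral_one_minus_square_powr[OF continuous_on_even_remainder[OF f] remainder]
    by (subst analytic_on_open) (auto simp: open_halfspace_Re_lt)
  then show ?thesis
    unfolding even_continuation_def[abs_def]
    by (intro meromorphic_on_add meromorphic_on_sum meromorphic_on_mult meromorphic_on_const
          meromorphic_on_Beta_half analytic_on_imp_meromorphic_on[of "\<lambda>\<alpha>. integral {0..1} (F \<alpha>)" for F])
qed

lemma has_integral_even_continuation:
  assumes \<alpha>: "Re \<alpha> < 1"
  shows "((\<lambda>x. f x * complex_of_real (1 - x\<^sup>2) powr (-\<alpha>)) has_integral even_continuation f c n \<alpha>) {-1..1}"
proof -
  define w where "w x = complex_of_real (1 - x\<^sup>2) powr (-\<alpha>)" for x :: real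
  have "bounded (f ` {-1..1})"
    by (intro compact_imp_bounded compact_continuous_image f) auto
  then obtain B where B: "\<And>x. x \<in> {-1..1} \<Longrightarrow> norm (f x) \<le> B"
    unfolding bounded_iff by blast
  have fw: "(\<lambda>x. f (s * x) * w x) integrable_on {0..1}" if "s \<in> {-1,1}" for s
  proof -
    have "(\<lambda>x. f (s * x) * w x) absolutely_integrable_on {0..1}"
      unfolding w_def
    \<comment> \<open>For Re \<alpha> < 1 boundedness of \<open>f\<close> is enough, so order 0 is
      used on each half of the interval.\<close>
    proof (rule absolutely_integrable_one_minus_square_powr[where m = 0 and C = B])
      show "continuous_on {0..<1} (\<lambda>x. f (s * x))"
        using that by (intro continuous_on_compose2[OF f] continuous_intros) auto
      show "norm (f (s * x)) \<le> B * (1 - x) ^ 0" if "x \<in> {0..<1}" for x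
        using that \<open>s \<in> {-1,1}\<close> B[of "s * x"] by auto
    qed (use \<alpha> in auto)
    then show ?thesis using set_lebesgue_integral_eq_integral(1) by blast
  qed
  define a b where "a = integral {0..1} (\<lambda>x. f x * w x)" and "b = integral {0..1} (\<lambda>x. f (- x) * w x)"
  have a: "((\<lambda>x. f x * w x) has_integral a) {0..1}"
    using fw[of 1] by (simp add: a_def integrable_integral)
  have b: "((\<lambda>x. f (- x) * w x) has_integral b) {0..1}"
    using fw[of "-1"] by (simp add: b_def integrable_integral)
  have "((\<lambda>x. f (- (- x)) * w (- x)) has_integral b) {-1..-0}"
    using b by (subst has_integral_reflect_real[of "\<lambda>x. f (- x) * w x"])
  then have b': "((\<lambda>x. f x * w x) has_integral b) {-1..0}"
    by (simp add: w_def)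
  have total: "((\<lambda>x. f x * w x) has_integral (b + a)) {-1..1}"
    by (rule has_integral_combine[OF _ _ b' a]) auto
  have "(\<lambda>x. even_remainder f c n x * w x) absolutely_integrable_on {0..1}"
    unfolding w_def
    by (intro absolutely_integrable_one_minus_square_powr[OF continuous_on_even_remainder[OF f] remainder])
       (use \<alpha> in auto)
  then have 1: "((\<lambda>x. even_remainder f c n x * w x) has_integral
      integral {0..1} (\<lambda>x. even_remainder f c n x * w x)) {0..1}"
    using set_lebesgue_integral_eq_integral(1) by blast
  have 2: "((\<lambda>x. \<Sum>k<n. c k * (-1) ^ k * (2 * complex_of_real (1 - x\<^sup>2) powr (- (\<alpha> - of_nat k)))) has_integral
      (\<Sum>k<n. c k * (-1) ^ k * Beta (1/2) (1 - (\<alpha> - of_nat k)))) {0..1}"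
    by (intro has_integral_sum has_integral_mult_right has_integral_one_minus_square_powr) (use \<alpha> in auto)
  have "((\<lambda>x. f x * w x + f (- x) * w x) has_integral even_continuation f c n \<alpha>) {0..1}"
  proof (rule has_integral_eq)
    show "((\<lambda>x. even_remainder f c n x * w x +
        (\<Sum>k<n. c k * (-1) ^ k * (2 * complex_of_real (1 - x\<^sup>2) powr (- (\<alpha> - of_nat k)))))
        has_integral even_continuation f c n \<alpha>) {0..1}"
      using has_integral_add[OF 1 2] by (simp add: even_continuation_def w_def algebra_simps)
    fix x :: real assume x: "x \<in> {0..1}"
    \<comment> \<open>This holds at x = 1 even for k = 0, because both powers of the base 0 are
      0.\<close>
    have "complex_of_real (1 - x\<^sup>2) powr (- (\<alpha> - of_nat k)) = of_real (1 - x\<^sup>2) ^ k * w x" for k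
    proof (cases "x = 1")
      case False
      with x have "x\<^sup>2 < 1" by (simp add: abs_square_less_1)
      then have "complex_of_real (1 - x\<^sup>2) \<noteq> 0"
        unfolding of_real_eq_0_iff by simp
      then show ?thesis
        unfolding w_def by (simp add: powr_diff powr_minus powr_nat' field_simps del: of_real_diff)
    qed (auto simp: w_def)
    moreover have "complex_of_real (x\<^sup>2 - 1) ^ k = (-1) ^ k * of_real (1 - x\<^sup>2) ^ k" for k
      by (metis minus_diff_eq of_real_minus power_minus)
    ultimately have "(\<Sum>k<n. c k * (-1) ^ k * (2 * complex_of_real (1 - x\<^sup>2) powr (- (\<alpha> - of_nat k)))) =
        2 * (\<Sum>k<n. c k * of_real (x\<^sup>2 - 1) ^ k) * w x"
      unfolding sum_distrib_left sum_distrib_right by (intro sum.cong) (simp_all only: mult_ac)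
    then show "even_remainder f c n x * w x +
        (\<Sum>k<n. c k * (-1) ^ k * (2 * complex_of_real (1 - x\<^sup>2) powr (- (\<alpha> - of_nat k)))) =
        f x * w x + f (- x) * w x"
      unfolding even_remainder_def by (simp only: left_diff_distrib distrib_right diff_add_cancel)
  qed
  moreover have "((\<lambda>x. f x * w x + f (- x) * w x) has_integral (a + b)) {0..1}"
    by (rule has_integral_add[OF a b])
  ultimately have "a + b = even_continuation f c n \<alpha>"
    using has_integral_unique by blast
  with total show ?thesis
    by (simp add: w_def add.commute)
qed

end

text \<open>The identity theorem gives equality only off a sparse set. Near z the function f then
  has the finite limit g z, so z is not a pole, and being nicely meromorphic forces the value of f
  at z to be this limit.\<close>

lemma nicely_meromorphic_eq_at_analytic_point:
  assumes A: "open A" "connected A" and U: "open U" "U \<noteq> {}" "U \<subseteq> A"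
    and f: "f nicely_meromorphic_on A" and g: "g meromorphic_on A"
    and eq: "\<And>z. z \<in> U \<Longrightarrow> f z = g z"
    and z: "z \<in> A" "g analytic_on {z}"
  shows "f analytic_on {z} \<and> f z = g z"
proof -
  have "(\<lambda>z. f z - g z) meromorphic_on A"
    using f g by (auto simp: nicely_meromorphic_on_def intro!: meromorphic_intros)
  \<comment> \<open>The difference is zero off a sparse set or nonzero off a sparse set; the latter
    contradicts its vanishing on the open set \<open>U\<close>.\<close>
  from meromorphic_imp_constant_or_avoid[OF this A, of 0]
  have "eventually (\<lambda>w. f w - g w = 0) (cosparse A)"
  proof
    assume *: "eventually (\<lambda>w. f w - g w \<noteq> 0) (cosparse A)"
    obtain u where u: "u \<in> U" using U by blast
    with * U A have "eventually (\<lambda>w. f w - g w \<noteq> 0) (at u)"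
      by (auto simp: eventually_cosparse_open_eq)
    moreover have "eventually (\<lambda>w. w \<in> U) (at u)"
      using u U(1) by (rule eventually_at_in_open'[rotated])
    ultimately have "eventually (\<lambda>w. False) (at u)"
      by eventually_elim (use eq in auto)
    then show ?thesis by simp
  qed
  then have ev: "eventually (\<lambda>w. f w = g w) (at z)"
    using z A by (auto simp: eventually_cosparse_open_eq)
  have "g \<midarrow>z\<rightarrow> g z"
    using z(2) by (simp add: analytic_at_imp_isCont isContD)
  then have lim: "f \<midarrow>z\<rightarrow> g z"
    using tendsto_cong[OF ev] by simp
  then have "\<not> is_pole f z"
    unfolding is_pole_def using not_tendsto_and_filterlim_at_infinity by (metis at_neq_bot)
  then have ana: "f analytic_on {z}"
    by (rule nicely_meromorphic_on_imp_analytic_at[OF f z(1)])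
  then have "f \<midarrow>z\<rightarrow> f z"
    by (simp add: analytic_at_imp_isCont isContD)
  with lim have "f z = g z"
    using LIM_unique by blast
  with ana show ?thesis ..
qed

text \<open>Quantifying over all continuations to half-planes containing n + 1/2 makes the value
  independent of the choice; the existence clause keeps this from being vacuous.\<close>

theorem mainTheorem4:
  fixes n :: nat and f F G :: "real \<Rightarrow> complex"
  assumes "n \<ge> 1"
    and "n_times_continuously_differentiable_on n f {-1..1}"
    and F: "\<And>y. y \<in> {0..1} \<Longrightarrow> F y = (f (sqrt y) + f (- sqrt y)) / 2"
    and G: "\<And>y. y \<in> {0..1} \<Longrightarrow> G y =
      complex_of_real (y powr (- 1 / 2) * (1 - y) powr (- real n - 1 / 2)) *
        (F y - (\<Sum>k<n. complex_of_real ((y - 1) ^ k / fact k) * nderiv_within k F {0..1} 1))"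
  shows "G absolutely_integrable_on {0..1} \<and>
    (\<exists>I. is_meromorphic_continuation f {\<alpha>. Re \<alpha> < real n + 1} I) \<and>
    (\<forall>c I. c > real n + 1 / 2 \<longrightarrow> is_meromorphic_continuation f {\<alpha>. Re \<alpha> < c} I \<longrightarrow>
       I analytic_on {of_nat n + 1 / 2} \<and> I (of_nat n + 1 / 2) = integral {0..1} G)"
proof -
  have "cont_diff n f {-1..1}"
    using assms(2) by (subst cont_diff_iff_n_times_continuously_differentiable_on)
      (auto simp: trivial_limit_within islimpt_Icc)
  then have f: "continuous_on {-1..1} f"
    by (rule cont_diff_imp_continuous_on)
  define c where "c k = nderiv_within k F {0..1} 1 / fact k" for k
  define R where "R y = F y - (\<Sum>k<n. of_real ((y - 1) ^ k / fact k) * nderiv_within k F {0..1} 1)" for y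
  define r where "r = even_remainder f c n"
  define w where "w x = complex_of_real (1 - x\<^sup>2) powr (- (of_nat n + 1/2))" for x :: real
  let ?J = "even_continuation f c n"
  let ?z = "complex_of_nat n + 1/2"

  have r_eq: "r x = 2 * R (x\<^sup>2)" if "x \<in> {0..1}" for x
  proof -
    have "x\<^sup>2 \<in> {0..1}" using that by (auto simp: power_le_one)
    from F[OF this] show ?thesis
      using that by (simp add: r_def even_remainder_def R_def c_def right_diff_distrib mult_ac)
  qed
  have "nderiv_within k F {0..1} 1 = nderiv_within k F {0<..1} 1" for k
    by (rule nderiv_within_cong) (auto simp: at_within_Icc_eq_Ioc)
  then obtain C1 where C1: "\<And>y. y \<in> {1/4..1} \<Longrightarrow> norm (R y) \<le> C1 * (1 - y) ^ n"
    unfolding R_def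
    using norm_Taylor_remainder_right_le[of n F "1/4"] assms(1)
      n_times_continuously_differentiable_on_even_part_sqrt[OF assms(2) F] by auto
  have "continuous_on {0..1/2} (even_remainder f c n)"
    by (rule continuous_on_subset[OF continuous_on_even_remainder[OF f]]) auto
  then have "bounded (even_remainder f c n ` {0..1/2})"
    by (intro compact_imp_bounded compact_continuous_image) auto
  then obtain B where B: "\<And>x. x \<in> {0..1/2} \<Longrightarrow> norm (r x) \<le> B" "B > 0"
    unfolding bounded_pos r_def by blast
  \<comment> \<open>The split at x = 1/2 corresponds to y = 1/4. To the left 1 - x is at least 1/2,
    giving \<open>B * 2 ^ n\<close>; to the right 1 - x^2 is at most 2 (1 - x), and \<open>r\<close>
    is twice \<open>R\<close>.\<close>
  define C where "C = max (2 * max C1 0 * 2 ^ n) (B * 2 ^ n)"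
  have r_le: "norm (r x) \<le> C * (1 - x) ^ n" if x: "x \<in> {0..<1}" for x
  proof (cases "x \<le> 1/2")
    case True
    have "1 = (2 * (1/2 :: real)) ^ n" by simp
    also have "\<dots> \<le> (2 * (1 - x)) ^ n"
      using True x by (intro power_mono) auto
    finally have *: "1 \<le> 2 ^ n * (1 - x) ^ n"
      by (simp only: power_mult_distrib)
    have "norm (r x) \<le> B * 1"
      using B True x by simp
    also have "\<dots> \<le> B * (2 ^ n * (1 - x) ^ n)"
      using B(2) * by (intro mult_left_mono) auto
    also have "\<dots> = B * 2 ^ n * (1 - x) ^ n"
      by simp
    also have "\<dots> \<le> C * (1 - x) ^ n"
      using x by (intro mult_right_mono) (auto simp: C_def)
    finally show ?thesis .
  next
    case False
    have "(1/2)\<^sup>2 \<le> x\<^sup>2" "x\<^sup>2 \<le> 1"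
      using False x by (auto intro!: power_mono power_le_one)
    then have y: "x\<^sup>2 \<in> {1/4..1}"
      by (auto simp: power2_eq_square)
    have "norm (r x) \<le> 2 * (C1 * (1 - x\<^sup>2) ^ n)"
      using C1[OF y] x by (simp add: r_eq norm_mult)
    also have "\<dots> \<le> 2 * (max C1 0 * (2 * (1 - x)) ^ n)"
    proof (intro mult_left_mono mult_mono power_mono)
      have "1 - x\<^sup>2 = (1 + x) * (1 - x)"
        by (simp add: algebra_simps power2_eq_square)
      also have "\<dots> \<le> 2 * (1 - x)"
        using x by (intro mult_right_mono) auto
      finally show "1 - x\<^sup>2 \<le> 2 * (1 - x)" .
    qed (use y in auto)
    also have "\<dots> = 2 * max C1 0 * 2 ^ n * (1 - x) ^ n"
      by (simp only: power_mult_distrib mult_ac)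
    also have "\<dots> \<le> C * (1 - x) ^ n"
      using x by (intro mult_right_mono) (auto simp: C_def)
    finally show ?thesis .
  qed
  note remainder = r_le[unfolded r_def]

  have rw: "(\<lambda>x. r x * w x) absolutely_integrable_on {0..1}"
    unfolding r_def w_def
    by (intro absolutely_integrable_one_minus_square_powr[OF continuous_on_even_remainder[OF f] remainder]) auto
  \<comment> \<open>The factor y^(-1/2) cancels the x of the Jacobian 2 x, and the remaining 2 is
    the one in \<open>r_eq\<close>. The cancellation fails at x = 0.\<close>
  have G_eq: "(2 * x) *\<^sub>R G (x\<^sup>2) = r x * w x" if x: "x \<in> {0..1} - {0}" for x
  proof -
    have x2: "x\<^sup>2 \<in> {0..1}" and x': "x > 0" "x \<in> {0..1}"
      using x by (auto simp: power_le_one)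
    have "(x\<^sup>2) powr (-1/2) = inverse x"
      using x' by (simp add: powr_powr powr_minus flip: powr_numeral)
    then have "complex_of_real (2 * x) * complex_of_real ((x\<^sup>2) powr (-1/2)) = 2"
      using x' by simp
    moreover have "complex_of_real ((1 - x\<^sup>2) powr (- real n - 1/2)) = w x"
      using powr_of_real[of "1 - x\<^sup>2" "- real n - 1/2"] x2 by (simp add: w_def)
    ultimately show ?thesis
      unfolding G[OF x2] R_def[symmetric] r_eq[OF x'(2)] scaleR_conv_of_real of_real_mult
      by (simp add: mult_ac)
  qed
  have "(\<lambda>x. (2 * x) *\<^sub>R G (x\<^sup>2)) absolutely_integrable_on {0..1}"
    using rw by (rule absolutely_integrable_spike[of _ _ "{0}"]) (use G_eq in auto)
  moreover have "integral {0..1} (\<lambda>x. (2 * x) *\<^sub>R G (x\<^sup>2)) = integral {0..1} (\<lambda>x. r x * w x)"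
    by (rule integral_spike[of "{0}"]) (use G_eq in auto)
  ultimately have G_int: "G absolutely_integrable_on {0..1}"
    "integral {0..1} G = integral {0..1} (\<lambda>x. r x * w x)"
    using absolutely_integrable_square_substitution_iff[of G] by blast+

  have J_Re_less_1: "?J analytic_on {\<alpha>}" if "Re \<alpha> < 1" for \<alpha>
  proof (rule analytic_on_even_continuation[OF f remainder])
    show "1 + of_nat k - \<alpha> \<notin> \<int>\<^sub>\<le>\<^sub>0" for k
      using that by (auto elim!: nonpos_Ints_cases dest!: arg_cong[of _ _ Re])
  qed (use that in auto)
  have J_half: "?J analytic_on {?z}"
  proof (rule analytic_on_even_continuation[OF f remainder])
    \<comment> \<open>The argument is a half-integer: doubling it would equate an odd and an even
      integer.\<close>
    show "1 + of_nat k - ?z \<notin> \<int>\<^sub>\<le>\<^sub>0" for k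
    proof
      assume "1 + of_nat k - ?z \<in> \<int>\<^sub>\<le>\<^sub>0"
      then obtain m where "1 + of_nat k - ?z = of_int m"
        by (auto elim!: nonpos_Ints_cases)
      then have "of_int (2 * (1 + int k - int n) - 1) = (of_int (2 * m) :: complex)"
        by (simp add: field_simps)
      then have "2 * (1 + int k - int n) - 1 = 2 * m"
        by (simp only: of_int_eq_iff)
      then show False by presburger
    qed
  qed auto
  \<comment> \<open>At a pole the candidate carries values dictated by the convention for \<Gamma>
    there. \<open>remove_sings\<close> normalises them and changes nothing for Re \<alpha> < 1,
    where the candidate is analytic.\<close>
  have "is_meromorphic_continuation f {\<alpha>. Re \<alpha> < real n + 1} (remove_sings ?J)"
    unfolding is_meromorphic_continuation_def
    using remove_sings_nicely_meromorphic[OF meromorphic_on_even_continuation[OF f remainder]]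
      has_integral_even_continuation[OF f remainder] J_Re_less_1
    by auto
  moreover have "I analytic_on {?z} \<and> I ?z = integral {0..1} G"
    if b: "b > real n + 1/2" and I: "is_meromorphic_continuation f {\<alpha>. Re \<alpha> < b} I" for b I
  proof -
    \<comment> \<open>The common half-plane of \<open>I\<close> and the candidate: it is convex,
      hence connected, and contains both Re \<alpha> < 1 and the point n + 1/2.\<close>
    define A where "A = {\<alpha>. Re \<alpha> < min b (real n + 1)}"
    have "I analytic_on {?z} \<and> I ?z = ?J ?z"
    proof (rule nicely_meromorphic_eq_at_analytic_point[of A "{\<alpha>. Re \<alpha> < 1}" I ?J])
      show "open A" "connected A"
        unfolding A_def by (rule open_halfspace_Re_lt, intro convex_connected convex_halfspace_Re_lt)
      show "{\<alpha>. Re \<alpha> < 1} \<subseteq> A" "?z \<in> A"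
        using b assms(1) by (auto simp: A_def)
      show "I nicely_meromorphic_on A"
        using I unfolding is_meromorphic_continuation_def
        by (auto simp: A_def intro: nicely_meromorphic_on_subset)
      show "?J meromorphic_on A"
        by (rule meromorphic_on_subset[OF meromorphic_on_even_continuation[OF f remainder]])
          (auto simp: A_def)
      show "I \<alpha> = ?J \<alpha>" if "\<alpha> \<in> {\<alpha>. Re \<alpha> < 1}" for \<alpha>
        using I that has_integral_even_continuation[OF f remainder, of \<alpha>] has_integral_unique
        unfolding is_meromorphic_continuation_def by blast
      show "{\<alpha>. Re \<alpha> < 1} \<noteq> {}"
        using zero_neq_one by (auto intro!: exI[of _ 0])
    qed (auto simp: open_halfspace_Re_lt J_half)
    then show ?thesis
      by (simp add: G_int even_continuation_at_half r_def w_def)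
  qed
  ultimately show ?thesis
    using G_int by blast
qed

end
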